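(* Let $n\equiv 0,\pm1 \bmod 8$ be a positive integer such that $X_n=\mathrm{O}_n(\mathbb{R})\backslash\mathcal{L}_n$ has exactly one element (that is, $n\le 9$). Let $(W,\rho)$ be a finite-dimensional complex representation of $\mathrm{SO}_n(\mathbb{R})$, let $A$ be a finite abelian group, let $L_0\in\mathcal{L}_n$, and let $\mathrm{vois}_A(L_0)$ be the set of $A$-neighbours of $L_0$. The group $\mathrm{SO}(L_0)$ acts naturally on $\mathrm{vois}_A(L_0)$; denote by $\mathcal{V}_j$ the orbits of this action, and for each $j$ choose $g_j\in\mathrm{SO}_n(\mathbb{R})$ with $g_j L_0\in\mathcal{V}_j$ (this is always possible since $|X_n|=1$). Then $$\mathrm{tr}\left(\mathrm{T}_A\,|\,\mathcal{M}_W(\mathrm{SO}_n)\right)=\frac{1}{|\mathrm{SO}(L_0)|}\sum_j\left(|\mathcal{V}_j|\sum_{\gamma\in\mathrm{SO}(L_0)}\mathrm{tr}(\gamma g_j\,|\,W)\right).$$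
   Context: $\mathbb{R}^n$ carries its usual inner product. For $n\equiv 0,\pm1\bmod 8$, $\mathcal{L}_n$ is the set of even lattices $L\subset\mathbb{R}^n$ (i.e. $x\cdot y\in\mathbb{Z}$ and $x\cdot x\in2\mathbb{Z}$ for $x,y\in L$) with $\det(L)=1$ if $n$ is even and $\det(L)=2$ if $n$ is odd. For $L\in\mathcal{L}_n$, $\mathrm{SO}(L)=\{g\in\mathrm{SO}_n(\mathbb{R}): gL=L\}$, a finite group. For a finite abelian group $A$, two lattices $L_1,L_2\in\mathcal{L}_n$ are $A$-neighbours if $L_1/(L_1\cap L_2)\simeq L_2/(L_1\cap L_2)\simeq A$. For a finite-dimensional complex representation $(W,\rho)$ of $\mathrm{SO}_n(\mathbb{R})$, $\mathcal{M}_W(\mathrm{SO}_n)$ is the finite-dimensional space of functions $f:\mathcal{L}_n\to W$ with $f(\gamma L)=\rho(\gamma)f(L)$ for all $\gamma\in\mathrm{SO}_n(\mathbb{R})$ and $L\in\mathcal{L}_n$. The Hecke operator $\mathrm{T}_A$ acts on it by $\mathrm{T}_A(f)(L)=\sum_{L'} f(L')$, the sum being over all $A$-neighbours $L'$ of $L$. *)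

theory Defs
  imports
    "HOL-Analysis.Analysis"
    "HOL-Algebra.Group_Action"
    "HOL-Library.Function_Algebras"
begin

(* The ambient Euclidean space R^n is the type real^'n, so n = CARD('n) and n >= 1. *)

definition is_lattice_basis :: "('n \<Rightarrow> real^'n) \<Rightarrow> (real^'n) set \<Rightarrow> bool" where
  "is_lattice_basis b L \<longleftrightarrow>
     inj b \<and> independent (range b) \<and>
     L = {(\<Sum>i\<in>UNIV. of_int (c i) *\<^sub>R b i) | c :: 'n \<Rightarrow> int. True}"

definition is_lattice :: "(real^'n) set \<Rightarrow> bool" where
  "is_lattice L \<longleftrightarrow> (\<exists>b. is_lattice_basis b L)"

definition gram_matrix :: "('n \<Rightarrow> real^'n) \<Rightarrow> real^'n^'n" where
  "gram_matrix b = (\<chi> i j. b i \<bullet> b j)"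

(* The Gram determinants of any two Z-bases of a lattice agree, so the description below
   picks out their common value. *)
definition lattice_det :: "(real^'n) set \<Rightarrow> real" where
  "lattice_det L = (THE d. \<exists>b. is_lattice_basis b L \<and> d = det (gram_matrix b))"

(* The set of lattices called L_n for n congruent to 0, 1 or -1 modulo 8. *)
definition even_lattices :: "(real^'n) set set" where
  "even_lattices = {L. is_lattice L
     \<and> (\<forall>x\<in>L. \<forall>y\<in>L. x \<bullet> y \<in> \<int>)
     \<and> (\<forall>x\<in>L. \<exists>k::int. x \<bullet> x = 2 * of_int k)
     \<and> lattice_det L = (if even CARD('n) then 1 else 2)}"

definition mat_act :: "real^'n^'n \<Rightarrow> (real^'n) set \<Rightarrow> (real^'n) set" where
  "mat_act g L = (\<lambda>x. g *v x) ` L"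

definition matrix_monoid :: "(real^'n^'n) set \<Rightarrow> (real^'n^'n) monoid" where
  "matrix_monoid S = \<lparr>carrier = S, monoid.mult = (**), one = mat 1\<rparr>"

definition O_n :: "(real^'n^'n) set" where
  "O_n = {g. orthogonal_matrix g}"

definition SO_n :: "(real^'n^'n) set" where
  "SO_n = {g. rotation_matrix g}"

definition X_n :: "(real^'n) set set set" where
  "X_n = orbits (matrix_monoid O_n) even_lattices mat_act"

definition SO_lattice :: "(real^'n) set \<Rightarrow> (real^'n^'n) set" where
  "SO_lattice L = {g \<in> SO_n. mat_act g L = L}"

definition additive_group :: "(real^'n) set \<Rightarrow> (real^'n) monoid" where
  "additive_group L = \<lparr>carrier = L, monoid.mult = (+), one = 0\<rparr>"

definition neighbours ::
    "('a, 'b) monoid_scheme \<Rightarrow> (real^'n) set \<Rightarrow> (real^'n) set \<Rightarrow> bool" where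
  "neighbours A L1 L2 \<longleftrightarrow> L1 \<in> even_lattices \<and> L2 \<in> even_lattices
     \<and> (additive_group L1 Mod (L1 \<inter> L2)) \<cong> A
     \<and> (additive_group L2 Mod (L1 \<inter> L2)) \<cong> A"

definition vois :: "('a, 'b) monoid_scheme \<Rightarrow> (real^'n) set \<Rightarrow> (real^'n) set set" where
  "vois A L = {L'. neighbours A L L'}"

definition vois_orbits ::
    "('a, 'b) monoid_scheme \<Rightarrow> (real^'n) set \<Rightarrow> (real^'n) set set set" where
  "vois_orbits A L = orbits (matrix_monoid (SO_lattice L)) (vois A L) mat_act"

(* A vector space W over a field is a type 'w with a scalar multiplication; the zero space
   is allowed. *)
definition fin_dim_space :: "('k::field \<Rightarrow> 'w::ab_group_add \<Rightarrow> 'w) \<Rightarrow> bool" where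
  "fin_dim_space sm \<longleftrightarrow> (\<exists>B. finite_dimensional_vector_space sm B)"

(* Only the values of \<rho> on SO_n matter. *)
definition is_SO_rep ::
    "(complex \<Rightarrow> 'w::ab_group_add \<Rightarrow> 'w) \<Rightarrow> (real^'n^'n \<Rightarrow> 'w \<Rightarrow> 'w) \<Rightarrow> bool" where
  "is_SO_rep sm \<rho> \<longleftrightarrow>
     (\<forall>g\<in>SO_n. Vector_Spaces.linear sm sm (\<rho> g)) \<and>
     \<rho> (mat 1) = id \<and>
     (\<forall>g\<in>SO_n. \<forall>h\<in>SO_n. \<rho> (g ** h) = \<rho> g \<circ> \<rho> h)"

(* Trace of a linear endomorphism f of the finite-dimensional subspace V, as the sum of the
   diagonal coefficients in a basis of V (any basis gives the same value). *)
definition trace_on ::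
    "('k::field \<Rightarrow> 'v::ab_group_add \<Rightarrow> 'v) \<Rightarrow> 'v set \<Rightarrow> ('v \<Rightarrow> 'v) \<Rightarrow> 'k" where
  "trace_on sm V f =
     (let B = (SOME B. \<not> module.dependent sm B \<and> module.span sm B = V)
      in \<Sum>b\<in>B. module.representation sm B (f b) b)"

definition fun_scale :: "('k \<Rightarrow> 'w \<Rightarrow> 'w) \<Rightarrow> 'k \<Rightarrow> ('l \<Rightarrow> 'w) \<Rightarrow> 'l \<Rightarrow> 'w" where
  "fun_scale sm c f = (\<lambda>x. sm c (f x))"

(* A function on even_lattices is represented by its extension by 0 to all sets. *)
definition M_W ::
    "(real^'n^'n \<Rightarrow> 'w \<Rightarrow> 'w) \<Rightarrow> ((real^'n) set \<Rightarrow> 'w::ab_group_add) set" where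
  "M_W \<rho> = {f. (\<forall>L. L \<notin> even_lattices \<longrightarrow> f L = 0) \<and>
     (\<forall>\<gamma>\<in>SO_n. \<forall>L\<in>even_lattices. f (mat_act \<gamma> L) = \<rho> \<gamma> (f L))}"

(* For L outside even_lattices the set vois A L is empty and the sum is 0, in accordance
   with the extension by 0. *)
definition hecke_T :: "('a, 'b) monoid_scheme \<Rightarrow>
    ((real^'n) set \<Rightarrow> 'w::ab_group_add) \<Rightarrow> (real^'n) set \<Rightarrow> 'w" where
  "hecke_T A f L = (\<Sum>L'\<in>vois A L. f L')"

end

theory Submission
  imports Defs "HOL-Algebra.Multiplicative_Group"
begin

text \<open>Every even lattice of the prescribed determinant is \<open>g L0\<close> with g in \<open>SO_n\<close>: the
  hypothesis on \<open>X_n\<close> gives g in \<open>O_n\<close>, and L0 has an automorphism of determinant -1, namely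
  -1 for n odd, and for n divisible by 8 the transposition of two coordinates of \<open>D\<^sub>n\<^sup>+\<close>, to which L0 must be isometric.
  Hence f in \<open>M_W\<close> is determined by f(L0), and by orbit counting \<open>T_A(f)(L0) = \<Theta> (f(L0))\<close>, where
  \<open>\<Theta> = 1/|SO(L0)| \<Sum>\<^sub>j |V\<^sub>j| \<Sum>\<^sub>\<gamma> \<rho>(\<gamma> g\<^sub>j)\<close> maps W to its \<open>SO(L0)\<close>-invariants. So \<open>T_A\<close> is the evaluation
  \<open>M_W \<rightarrow> W\<close> followed by the extension map \<open>\<psi> : W \<rightarrow> M_W\<close> with \<open>\<psi>(w)(h L0) = \<rho>(h) (\<Theta> w)\<close>. The
  opposite composition is \<open>\<Theta>\<close> on W, and the two compositions have the same trace.\<close>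

section \<open>Traces\<close>

text \<open>The choice made inside \<open>trace_on\<close> depends on V but not on the endomorphism,
  so a single B serves all f. Traces of different maps on V can therefore be compared coefficient by
  coefficient, without proving that the trace is independent of the basis.\<close>

lemma trace_on_basis:
  assumes "vector_space sm" "module.subspace sm V"
  obtains B where "\<not> module.dependent sm B" "module.span sm B = V"
    "\<And>f. trace_on sm V f = (\<Sum>b\<in>B. module.representation sm B (f b) b)"
proof -
  interpret vector_space sm by fact
  obtain B where "independent B" "span B = V"
    using basis_exists[of V] assms(2) span_minimal by (metis subset_antisym)
  hence "\<exists>B. independent B \<and> span B = V" by blast
  from someI_ex[OF this] that show thesis unfolding trace_on_def Let_def by blast
qed

lemma trace_on_cong:
  assumes "vector_space sm" "module.subspace sm V" "\<And>x. x \<in> V \<Longrightarrow> f x = g x"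
  shows "trace_on sm V f = trace_on sm V g"
proof -
  interpret vector_space sm by fact
  obtain B where "span B = V"
    and tr: "\<And>f. trace_on sm V f = (\<Sum>b\<in>B. representation B (f b) b)"
    using trace_on_basis[OF assms(1,2)] by blast
  then show ?thesis unfolding tr using assms(3) span_base by (intro sum.cong) auto
qed

lemma (in vector_space) representation_sum_scale:
  assumes "independent B" "\<And>i. i \<in> I \<Longrightarrow> v i \<in> span B"
  shows "representation B (\<Sum>i\<in>I. scale (c i) (v i)) b = (\<Sum>i\<in>I. c i * representation B (v i) b)"
  using assms
  by (subst representation_sum) (auto simp: representation_scale span_scale)

text \<open>Expanding in the bases B and C picked by \<open>trace_on\<close>, both traces become the
  same double sum of products of matrix coefficients of \<phi> and \<psi>. Finiteness is asked only
  of bases of U and V, because the ambient space of functions may be infinite-dimensional.\<close>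

lemma (in vector_space_pair) trace_on_commute:
  assumes lin: "Vector_Spaces.linear s1 s2 \<phi>" "Vector_Spaces.linear s2 s1 \<psi>"
    and sub: "vs1.subspace U" "vs2.subspace V"
    and im: "\<phi> ` U \<subseteq> V" "\<psi> ` V \<subseteq> U"
    and fin: "\<And>B. vs1.independent B \<Longrightarrow> vs1.span B = U \<Longrightarrow> finite B"
      "\<And>B. vs2.independent B \<Longrightarrow> vs2.span B = V \<Longrightarrow> finite B"
  shows "trace_on s1 U (\<psi> \<circ> \<phi>) = trace_on s2 V (\<phi> \<circ> \<psi>)"
proof -
  interpret \<phi>: Vector_Spaces.linear s1 s2 \<phi> by fact
  interpret \<psi>: Vector_Spaces.linear s2 s1 \<psi> by fact
  obtain B where B: "vs1.independent B" "vs1.span B = U"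
    and trB: "\<And>f. trace_on s1 U f = (\<Sum>b\<in>B. vs1.representation B (f b) b)"
    using trace_on_basis[OF vs1.vector_space_axioms sub(1)] by blast
  obtain C where C: "vs2.independent C" "vs2.span C = V"
    and trC: "\<And>f. trace_on s2 V f = (\<Sum>c\<in>C. vs2.representation C (f c) c)"
    using trace_on_basis[OF vs2.vector_space_axioms sub(2)] by blast
  note finB = fin(1)[OF B] and finC = fin(2)[OF C]
  have inC: "c \<in> V" if "c \<in> C" for c using that C(2) vs2.span_base by blast
  have inB: "b \<in> U" if "b \<in> B" for b using that B(2) vs1.span_base by blast
  have 1: "vs1.representation B (\<psi> (\<phi> b)) b =
      (\<Sum>c\<in>C. vs2.representation C (\<phi> b) c * vs1.representation B (\<psi> c) b)" if "b \<in> B" for b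
  proof -
    have "\<phi> b = (\<Sum>c\<in>C. s2 (vs2.representation C (\<phi> b) c) c)"
      using vs2.sum_representation_eq[OF C(1) _ finC order_refl, of "\<phi> b"] C(2) im inB[OF that] by auto
    hence "\<psi> (\<phi> b) = (\<Sum>c\<in>C. s1 (vs2.representation C (\<phi> b) c) (\<psi> c))"
      by (metis (no_types, lifting) \<psi>.scale \<psi>.sum sum.cong)
    hence "vs1.representation B (\<psi> (\<phi> b)) b =
        vs1.representation B (\<Sum>c\<in>C. s1 (vs2.representation C (\<phi> b) c) (\<psi> c)) b" by simp
    thus ?thesis
      using B C(2) im inC
      by (simp add: vs1.representation_sum_scale image_subset_iff)
  qed
  have 2: "vs2.representation C (\<phi> (\<psi> c)) c =
      (\<Sum>b\<in>B. vs1.representation B (\<psi> c) b * vs2.representation C (\<phi> b) c)" if "c \<in> C" for c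
  proof -
    have "\<psi> c = (\<Sum>b\<in>B. s1 (vs1.representation B (\<psi> c) b) b)"
      using vs1.sum_representation_eq[OF B(1) _ finB order_refl, of "\<psi> c"] B(2) im inC[OF that] by auto
    hence "\<phi> (\<psi> c) = (\<Sum>b\<in>B. s2 (vs1.representation B (\<psi> c) b) (\<phi> b))"
      by (metis (no_types, lifting) \<phi>.scale \<phi>.sum sum.cong)
    hence "vs2.representation C (\<phi> (\<psi> c)) c =
        vs2.representation C (\<Sum>b\<in>B. s2 (vs1.representation B (\<psi> c) b) (\<phi> b)) c" by simp
    thus ?thesis
      using C B(2) im inB by (simp add: vs2.representation_sum_scale image_subset_iff)
  qed
  show ?thesis unfolding trB trC o_def using 1 2
    by (simp add: sum.swap[of _ C B] mult.commute)
qed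

lemma trace_on_sum_scale:
  assumes "vector_space sm" "module.subspace sm V"
    and "\<And>i x. i \<in> I \<Longrightarrow> x \<in> V \<Longrightarrow> f i x \<in> V"
  shows "trace_on sm V (\<lambda>x. \<Sum>i\<in>I. sm (c i) (f i x)) = (\<Sum>i\<in>I. c i * trace_on sm V (f i))"
proof -
  interpret vector_space sm by fact
  obtain B where B: "independent B" "span B = V"
    and tr: "\<And>f. trace_on sm V f = (\<Sum>b\<in>B. representation B (f b) b)"
    using trace_on_basis[OF assms(1,2)] by blast
  have "b \<in> V" if "b \<in> B" for b using that B(2) span_base by blast
  thus ?thesis unfolding tr using B assms(3)
    by (simp add: representation_sum_scale sum_distrib_left sum.swap[of _ B I])
qed

section \<open>Even lattices\<close>

lemma mat_act_mult: "mat_act (g ** h) L = mat_act g (mat_act h L)"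
  by (simp add: mat_act_def image_image matrix_vector_mul_assoc)

lemma mat_act_one [simp]: "mat_act (mat 1) L = L"
  by (simp add: mat_act_def)

lemma O_n_mult: "g \<in> O_n \<Longrightarrow> h \<in> O_n \<Longrightarrow> g ** h \<in> O_n"
  by (simp add: O_n_def orthogonal_matrix_mul)

lemma SO_n_subset_O_n: "SO_n \<subseteq> O_n"
  by (auto simp: SO_n_def O_n_def rotation_matrix_def)

lemma SO_n_mult: "g \<in> SO_n \<Longrightarrow> h \<in> SO_n \<Longrightarrow> g ** h \<in> SO_n"
  by (simp add: SO_n_def rotation_matrix_def orthogonal_matrix_mul det_mul)

lemma SO_n_one [simp]: "mat 1 \<in> SO_n"
  by (simp add: SO_n_def rotation_matrix_def orthogonal_matrix_id)

lemma O_n_transpose: "g \<in> O_n \<Longrightarrow> transpose g \<in> O_n"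
  by (simp add: O_n_def)

lemma SO_n_transpose: "g \<in> SO_n \<Longrightarrow> transpose g \<in> SO_n"
  by (simp add: SO_n_def rotation_matrix_def)

lemma O_n_transpose_mult:
  "g \<in> O_n \<Longrightarrow> transpose g ** g = mat 1" "g \<in> O_n \<Longrightarrow> g ** transpose g = mat 1"
  by (auto simp: O_n_def orthogonal_matrix_def)

lemma mat_act_transpose [simp]:
  assumes "g \<in> O_n"
  shows "mat_act (transpose g) (mat_act g L) = L" "mat_act g (mat_act (transpose g) L) = L"
  using O_n_transpose_mult[OF assms] by (metis mat_act_mult mat_act_one)+

lemma O_n_inner: "g \<in> O_n \<Longrightarrow> (g *v x) \<bullet> (g *v y) = x \<bullet> y"
  using orthogonal_transformation_matrix[of "(*v) g"]
  by (auto simp: O_n_def orthogonal_transformation_def)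

lemma O_n_inj: "g \<in> O_n \<Longrightarrow> inj ((*v) g)"
  by (metis O_n_transpose_mult(1) inj_on_inverseI matrix_vector_mul_assoc matrix_vector_mul_lid)

lemma is_lattice_basis_mat_act:
  assumes "g \<in> O_n" "is_lattice_basis b L"
  shows "is_lattice_basis (\<lambda>i. g *v b i) (mat_act g L)"
  unfolding is_lattice_basis_def
proof (intro conjI)
  have b: "inj b" "independent (range b)"
    and L: "L = {(\<Sum>i\<in>UNIV. of_int (c i) *\<^sub>R b i) | c. True}"
    using assms(2) unfolding is_lattice_basis_def by blast+
  show "inj (\<lambda>i. g *v b i)"
    using inj_compose[OF O_n_inj[OF assms(1)] b(1)] by (simp add: comp_def)
  have "independent ((*v) g ` range b)"
    using O_n_inj[OF assms(1)]
    by (intro linear_independent_injective_image b(2) matrix_vector_mul_linear)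
      (auto intro: inj_on_subset)
  thus "independent (range (\<lambda>i. g *v b i))" by (simp add: image_image)
  have "g *v (\<Sum>i\<in>UNIV. of_int (c i) *\<^sub>R b i) = (\<Sum>i\<in>UNIV. of_int (c i) *\<^sub>R (g *v b i))"
    for c :: "'a \<Rightarrow> int"
    by (simp add: linear_sum[OF matrix_vector_mul_linear] matrix_vector_mult_scaleR)
  thus "mat_act g L = {(\<Sum>i\<in>UNIV. of_int (c i) *\<^sub>R (g *v b i)) | c. True}"
    by (simp add: mat_act_def L full_SetCompr_eq image_image)
qed

text \<open>g carries bases to bases with the same Gram matrix, and \<open>transpose g\<close>
  carries them back. The two definite descriptions thus have equivalent predicates and agree,
  whether or not the value described is already known to be unique.\<close>

lemma lattice_det_mat_act:
  fixes g :: "real^'n^'n"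
  assumes "g \<in> O_n"
  shows "lattice_det (mat_act g L) = lattice_det L"
proof -
  have gram: "gram_matrix (\<lambda>i. h *v b i) = gram_matrix b" if "h \<in> O_n"
    for b :: "'n \<Rightarrow> real^'n" and h
    by (simp add: gram_matrix_def O_n_inner[OF that])
  have "(\<exists>b. is_lattice_basis b (mat_act g L) \<and> d = det (gram_matrix b)) \<longleftrightarrow>
      (\<exists>b. is_lattice_basis b L \<and> d = det (gram_matrix b))" for d
    using is_lattice_basis_mat_act[OF assms]
      is_lattice_basis_mat_act[OF O_n_transpose[OF assms], of _ "mat_act g L"]
      gram[OF assms] gram[OF O_n_transpose[OF assms]] assms
    by (metis mat_act_transpose(1))
  thus ?thesis by (simp add: lattice_det_def)
qed

lemma even_lattices_mat_act:
  assumes "g \<in> O_n" "L \<in> even_lattices"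
  shows "mat_act g L \<in> even_lattices"
  using assms is_lattice_basis_mat_act[OF assms(1)] lattice_det_mat_act[OF assms(1)]
  unfolding even_lattices_def is_lattice_def
  by (auto simp: mat_act_def O_n_inner)

section \<open>Group structure, spanning and finiteness for integral lattices\<close>

lemma lattice_basis_mem:
  "is_lattice_basis b L \<Longrightarrow> x \<in> L \<longleftrightarrow> (\<exists>c :: 'n \<Rightarrow> int. x = (\<Sum>i\<in>UNIV. of_int (c i) *\<^sub>R b i))"
  for b :: "'n::finite \<Rightarrow> real^'n"
  unfolding is_lattice_basis_def by blast

lemma
  assumes "is_lattice L"
  shows is_lattice_zero: "0 \<in> L"
    and is_lattice_add: "x \<in> L \<Longrightarrow> y \<in> L \<Longrightarrow> x + y \<in> L"
    and is_lattice_scaleR_int: "x \<in> L \<Longrightarrow> of_int k *\<^sub>R x \<in> L"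
proof -
  obtain b where b: "is_lattice_basis b L"
    using assms unfolding is_lattice_def by blast
  note mem = lattice_basis_mem[OF b]
  show "0 \<in> L" unfolding mem by (auto intro!: exI[of _ "\<lambda>_. 0"])
  show "x + y \<in> L" if xy: "x \<in> L" "y \<in> L"
  proof -
    obtain c d where "x = (\<Sum>i\<in>UNIV. of_int (c i) *\<^sub>R b i)" "y = (\<Sum>i\<in>UNIV. of_int (d i) *\<^sub>R b i)"
      using xy unfolding mem by blast
    thus ?thesis unfolding mem
      by (intro exI[of _ "\<lambda>i. c i + d i"]) (simp add: scaleR_left_distrib sum.distrib)
  qed
  show "of_int k *\<^sub>R x \<in> L" if x: "x \<in> L"
  proof -
    obtain c where "x = (\<Sum>i\<in>UNIV. of_int (c i) *\<^sub>R b i)"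
      using x unfolding mem by blast
    thus ?thesis unfolding mem
      by (intro exI[of _ "\<lambda>i. k * c i"]) (simp add: scaleR_sum_right)
  qed
qed

lemma is_lattice_uminus: "is_lattice L \<Longrightarrow> x \<in> L \<Longrightarrow> - x \<in> L"
  using is_lattice_scaleR_int[of L x "-1"] by simp

lemma is_lattice_sum:
  assumes "is_lattice L" "\<And>i. i \<in> I \<Longrightarrow> f i \<in> L"
  shows "(\<Sum>i\<in>I. f i) \<in> L"
  using assms(2) is_lattice_zero[OF assms(1)] is_lattice_add[OF assms(1)]
  by (induction I rule: infinite_finite_induct) auto

lemma lattice_basis_in:
  assumes "is_lattice_basis b L"
  shows "b i \<in> L"
  unfolding lattice_basis_mem[OF assms]
  by (rule exI[of _ "\<lambda>j. if j = i then 1 else 0"])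
    (simp add: if_distrib[of "\<lambda>c. of_int c *\<^sub>R _"] if_distrib[of of_int] if_distrib[of "\<lambda>c. c *\<^sub>R _"] cong: if_cong)

lemma lattice_basis_span:
  fixes b :: "'n \<Rightarrow> real^'n"
  assumes "is_lattice_basis b L"
  shows "span (range b) = UNIV"
proof -
  have "card (range b) = DIM(real^'n)"
    using assms by (simp add: is_lattice_basis_def card_image)
  thus ?thesis using assms
    by (metis is_lattice_basis_def card_ge_dim_independent dim_UNIV order_refl subset_UNIV
        top.extremum_uniqueI)
qed

text \<open>A vector is determined by its inner products with a basis. For x in L of norm at most r
  these are integers, bounded by \<open>r * norm (b i)\<close> by Cauchy-Schwarz, so only finitely
  many tuples occur.\<close>

lemma finite_lattice_cball:
  fixes L :: "(real^'n) set"
  assumes "is_lattice L" and int: "\<And>x y. x \<in> L \<Longrightarrow> y \<in> L \<Longrightarrow> x \<bullet> y \<in> \<int>"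
  shows "finite {x \<in> L. norm x \<le> r}"
proof -
  obtain b where b: "is_lattice_basis b L" using assms(1) is_lattice_def by blast
  define K where "K i = {z \<in> \<int>. \<bar>z\<bar> \<le> r * norm (b i)}" for i
  have "finite (K i)" for i unfolding K_def by (rule finite_abs_int_segment)
  hence "finite (PiE UNIV K)" by (intro finite_PiE) auto
  moreover have "(\<lambda>x i. x \<bullet> b i) ` {x \<in> L. norm x \<le> r} \<subseteq> PiE UNIV K"
    using int lattice_basis_in[OF b]
    by (auto simp: K_def intro!: order_trans[OF Cauchy_Schwarz_ineq2] mult_right_mono)
  moreover have "inj (\<lambda>x i. x \<bullet> b i)"
  proof (rule injI)
    fix x y assume "(\<lambda>i. x \<bullet> b i) = (\<lambda>i. y \<bullet> b i)"
    hence "orthogonal (x - y) v" if "v \<in> range b" for v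
      using that by (auto simp: orthogonal_def inner_diff_left fun_eq_iff)
    hence "orthogonal (x - y) (x - y)"
      using orthogonal_to_span lattice_basis_span[OF b] by blast
    thus "x = y" by (simp add: orthogonal_self)
  qed
  ultimately show ?thesis
    by (meson finite_imageD finite_subset inj_on_subset subset_UNIV)
qed

text \<open>An automorphism is determined by the images of a basis, and each image lies among the
  finitely many lattice vectors no longer than the basis vector it comes from.\<close>

lemma finite_SO_lattice:
  fixes L :: "(real^'n) set"
  assumes "L \<in> even_lattices"
  shows "finite (SO_lattice L)"
proof -
  have L: "is_lattice L" "\<And>x y. x \<in> L \<Longrightarrow> y \<in> L \<Longrightarrow> x \<bullet> y \<in> \<int>"
    using assms by (auto simp: even_lattices_def)
  obtain b where b: "is_lattice_basis b L" using L(1) is_lattice_def by blast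
  have "finite (PiE UNIV (\<lambda>i. {x \<in> L. norm x \<le> norm (b i)}))"
    using finite_lattice_cball[OF L] by (intro finite_PiE) auto
  moreover have "(\<lambda>g i. g *v b i) ` SO_lattice L \<subseteq> PiE UNIV (\<lambda>i. {x \<in> L. norm x \<le> norm (b i)})"
    using lattice_basis_in[OF b] SO_n_subset_O_n
    by (auto simp: SO_lattice_def mat_act_def norm_eq_sqrt_inner O_n_inner subset_iff)
  moreover have "inj (\<lambda>(g :: real^'n^'n) i. g *v b i)"
  proof (rule injI)
    fix g h :: "real^'n^'n" assume "(\<lambda>i. g *v b i) = (\<lambda>i. h *v b i)"
    hence "g *v v = h *v v" if "v \<in> range b" for v using that by (auto simp: fun_eq_iff)
    hence "g *v v = h *v v" for v
      using linear_eq_on_span[OF matrix_vector_mul_linear matrix_vector_mul_linear]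
        lattice_basis_span[OF b] by blast
    thus "g = h" by (simp add: matrix_eq)
  qed
  ultimately show ?thesis
    by (meson finite_imageD finite_subset inj_on_subset subset_UNIV)
qed

section \<open>Finiteness and equivariance of neighbours\<close>

lemma additive_group_simps [simp]:
  "carrier (additive_group L) = L" "x \<otimes>\<^bsub>additive_group L\<^esub> y = x + y" "\<one>\<^bsub>additive_group L\<^esub> = 0"
  by (simp_all add: additive_group_def)

lemma comm_group_additive_group:
  assumes "is_lattice L"
  shows "comm_group (additive_group L)"
proof (rule comm_groupI)
  show "\<exists>y\<in>carrier (additive_group L). y \<otimes>\<^bsub>additive_group L\<^esub> x = \<one>\<^bsub>additive_group L\<^esub>"
    if "x \<in> carrier (additive_group L)" for x
    using that is_lattice_uminus[OF assms, of x] by (auto intro!: bexI[of _ "- x"])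
qed (use is_lattice_zero[OF assms] is_lattice_add[OF assms] in \<open>auto simp: add_ac\<close>)

lemma additive_group_pow:
  "x [^]\<^bsub>additive_group L\<^esub> (k :: nat) = of_nat k *\<^sub>R x"
  by (induction k) (auto simp: scaleR_left_distrib nat_pow_def)

lemma subgroup_Int_additive_group:
  assumes "is_lattice L" "is_lattice L'"
  shows "subgroup (L \<inter> L') (additive_group L)"
proof -
  interpret comm_group "additive_group L" by (rule comm_group_additive_group) fact
  show ?thesis
  proof (rule subgroupI)
    show "inv\<^bsub>additive_group L\<^esub> x \<in> L \<inter> L'" if "x \<in> L \<inter> L'" for x
    proof -
      have "inv\<^bsub>additive_group L\<^esub> x = - x"
        using that is_lattice_uminus[OF assms(1)] by (intro inv_equality) auto
      thus ?thesis using that is_lattice_uminus assms by auto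
    qed
  qed (use is_lattice_zero[OF assms(1)] is_lattice_zero[OF assms(2)] is_lattice_add assms in auto)
qed

text \<open>Lagrange in the quotient, whose order is that of A: the corresponding power of the coset
  of x is trivial, and powers in \<open>additive_group L\<close> are integer multiples.\<close>

lemma FactGroup_exponent:
  assumes "is_lattice L" "is_lattice L'"
    and iso: "(additive_group L Mod (L \<inter> L')) \<cong> A" and fin: "finite (carrier A)" and x: "x \<in> L"
  shows "of_nat (card (carrier A)) *\<^sub>R x \<in> L'"
proof -
  interpret G: comm_group "additive_group L" by (rule comm_group_additive_group) fact
  let ?H = "L \<inter> L'"
  have sub: "subgroup ?H (additive_group L)"
    by (rule subgroup_Int_additive_group) fact+
  interpret normal ?H "additive_group L"
    using sub G.normal_iff_subgroup by blast
  interpret Q: group "additive_group L Mod ?H" by (rule factorgroup_is_group)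
  define a where "a = card (carrier A)"
  have ord: "order (additive_group L Mod ?H) = a"
    using iso_same_card[OF iso] by (simp add: order_def a_def)
  have C: "?H #>\<^bsub>additive_group L\<^esub> x \<in> carrier (additive_group L Mod ?H)"
    using x by (auto simp: carrier_FactGroup)
  have "(?H #>\<^bsub>additive_group L\<^esub> x) [^]\<^bsub>additive_group L Mod ?H\<^esub> a = ?H"
    using Q.pow_order_eq_1[OF C] ord by simp
  hence "?H #>\<^bsub>additive_group L\<^esub> (x [^]\<^bsub>additive_group L\<^esub> a) = ?H"
    using FactGroup_pow[of x a] x by simp
  moreover have "x [^]\<^bsub>additive_group L\<^esub> a \<in> L"
    using x G.nat_pow_closed by fastforce
  ultimately have "x [^]\<^bsub>additive_group L\<^esub> a \<in> ?H"
    using G.coset_join1[OF _ _ sub] by auto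
  thus ?thesis by (simp add: additive_group_pow a_def)
qed

lemma neighbours_scaled_subset:
  assumes "neighbours A L L'" "finite (carrier A)"
  shows "x \<in> L \<Longrightarrow> of_nat (card (carrier A)) *\<^sub>R x \<in> L'"
    and "x \<in> L' \<Longrightarrow> of_nat (card (carrier A)) *\<^sub>R x \<in> L"
  using assms FactGroup_exponent[of L L' A x] FactGroup_exponent[of L' L A x]
  by (auto simp: neighbours_def even_lattices_def Int_commute)

text \<open>With a the order of A, a neighbour of L lies between a L and (1/a) L, so it is determined by
  the coordinate vectors in [0, a^2) of its elements scaled by a.\<close>

lemma finite_vois:
  fixes A :: "('a, 'b) monoid_scheme" and L :: "(real^'n) set"
  assumes "comm_group A" "finite (carrier A)" "L \<in> even_lattices"
  shows "finite (vois A L)"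
proof -
  interpret A: comm_group A by fact
  define a where "a = card (carrier A)"
  have a: "a > 0" using assms(2) by (auto simp: a_def card_gt_0_iff)
  have L: "is_lattice L" using assms(3) by (simp add: even_lattices_def)
  then obtain b where b: "is_lattice_basis b L" using is_lattice_def by blast
  note mem = lattice_basis_mem[OF b]
  define C :: "('n \<Rightarrow> int) set" where "C = PiE UNIV (\<lambda>_. {0..<int (a\<^sup>2)})"
  define pt where "pt c = (1 / of_nat a) *\<^sub>R (\<Sum>i\<in>UNIV. of_int (c i) *\<^sub>R b i)" for c :: "'n \<Rightarrow> int"
  define S where "S M = {c \<in> C. pt c \<in> M}" for M
  have "finite C" unfolding C_def by (intro finite_PiE) auto
  moreover have "S ` vois A L \<subseteq> Pow C" by (auto simp: S_def)
  moreover have "inj_on S (vois A L)"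
  proof -
    have "M \<subseteq> N" if M: "M \<in> vois A L" and N: "N \<in> vois A L" and eq: "S M = S N" for M N
    proof
      fix x assume x: "x \<in> M"
      have lat: "is_lattice M" "is_lattice N"
        using M N by (auto simp: vois_def neighbours_def even_lattices_def)
      have "of_nat a *\<^sub>R x \<in> L"
        using neighbours_scaled_subset(2)[of A L M x] M x assms(2) by (simp add: vois_def a_def)
      then obtain k where k: "of_nat a *\<^sub>R x = (\<Sum>i\<in>UNIV. of_int (k i) *\<^sub>R b i)"
        unfolding mem by blast
      \<comment> \<open>Reducing the coordinates modulo a^2 changes x by
        \<open>of_nat a *\<^sub>R y\<close> with y in L. This multiple lies in both M and N, so x
        and \<open>pt c\<close> belong to the same ones among M and N.\<close>
      define c where "c i = k i mod int (a\<^sup>2)" for i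
      define y where "y = (\<Sum>i\<in>UNIV. of_int (k i div int (a\<^sup>2)) *\<^sub>R b i)"
      have y: "y \<in> L" unfolding mem y_def by (rule exI, rule refl)
      have "of_int (k i) = real_of_int (c i) + (of_nat a)\<^sup>2 * of_int (k i div int (a\<^sup>2))" for i
      proof -
        have "k i = c i + int (a\<^sup>2) * (k i div int (a\<^sup>2))" by (simp add: c_def)
        hence "real_of_int (k i) = of_int (c i + int (a\<^sup>2) * (k i div int (a\<^sup>2)))" by (rule arg_cong)
        thus ?thesis by simp
      qed
      hence "of_nat a *\<^sub>R x = (\<Sum>i\<in>UNIV. of_int (c i) *\<^sub>R b i) + (of_nat a)\<^sup>2 *\<^sub>R y"
        unfolding k y_def by (simp add: scaleR_left_distrib sum.distrib scaleR_sum_right)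
      hence "(1 / of_nat a) *\<^sub>R of_nat a *\<^sub>R x = pt c + (1 / of_nat a) *\<^sub>R (of_nat a)\<^sup>2 *\<^sub>R y"
        by (simp add: pt_def scaleR_right_distrib)
      hence x_eq: "x = pt c + of_nat a *\<^sub>R y" using a by (simp add: power2_eq_square)
      have ay: "of_nat a *\<^sub>R y \<in> M" "of_nat a *\<^sub>R y \<in> N"
        using neighbours_scaled_subset(1)[of A L _ y] M N y assms(2) by (auto simp: vois_def a_def)
      have "pt c = x + - (of_nat a *\<^sub>R y)" using x_eq by simp
      hence "pt c \<in> M" using is_lattice_add[OF lat(1) x is_lattice_uminus[OF lat(1) ay(1)]] by simp
      moreover have "c \<in> C" using a by (auto simp: C_def c_def)
      ultimately have "pt c \<in> N" using eq by (auto simp: S_def)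
      thus "x \<in> N" unfolding x_eq using is_lattice_add[OF lat(2)] ay(2) by blast
    qed
    thus ?thesis by (auto intro!: inj_onI)
  qed
  ultimately show ?thesis by (meson finite_Pow_iff finite_imageD finite_subset)
qed

text \<open>Direct image under f commutes with forming cosets and products of sets, and injectivity
  of f passes to sets; so the image map itself is the isomorphism of quotients.\<close>

lemma FactGroup_additive_image:
  fixes f :: "real^'n \<Rightarrow> real^'n"
  assumes "inj f" and add: "\<And>x y. f (x + y) = f x + f y"
  shows "(additive_group L Mod H) \<cong> (additive_group (f ` L) Mod (f ` H))"
proof (rule is_isoI)
  have coset: "f ` (H #>\<^bsub>additive_group L\<^esub> x) = (f ` H) #>\<^bsub>additive_group (f ` L)\<^esub> f x" for x
    by (simp add: r_coset_def add image_UN image_image)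
  have mult: "f ` (X <#>\<^bsub>additive_group L\<^esub> Y) = f ` X <#>\<^bsub>additive_group (f ` L)\<^esub> f ` Y" for X Y
    by (auto simp: set_mult_def add image_UN)
  have im: "(`) f ` carrier (additive_group L Mod H) = carrier (additive_group (f ` L) Mod f ` H)"
    by (simp add: carrier_FactGroup image_image coset)
  show "(`) f \<in> iso (additive_group L Mod H) (additive_group (f ` L) Mod f ` H)"
    unfolding iso_def hom_def
    using im mult assms(1) by (auto simp: bij_betw_def inj_on_def inj_image_eq_iff)
qed

lemma neighbours_mat_act:
  assumes g: "g \<in> O_n" and nb: "neighbours A L1 L2"
  shows "neighbours A (mat_act g L1) (mat_act g L2)"
proof -
  let ?h = "transpose g"
  have h: "?h \<in> O_n" using g by (rule O_n_transpose)
  have Int: "mat_act ?h (mat_act g L1 \<inter> mat_act g L2) = L1 \<inter> L2"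
    using image_Int[OF O_n_inj[OF h], of "mat_act g L1" "mat_act g L2"] g
    by (simp del: transpose_matrix_vector flip: mat_act_def)
  \<comment> \<open>Pulling back along the inverse of g gives the isomorphism from the new quotient
    to the old one, which composes directly with the given isomorphism to A. Leaving L free treats
    both neighbours at once.\<close>
  have "(additive_group (mat_act g L) Mod (mat_act g L1 \<inter> mat_act g L2)) \<cong>
      (additive_group L Mod (L1 \<inter> L2))" for L
    using FactGroup_additive_image[OF O_n_inj[OF h] matrix_vector_right_distrib,
        of "mat_act g L" "mat_act g L1 \<inter> mat_act g L2"] Int g
    by (simp del: transpose_matrix_vector flip: mat_act_def)
  thus ?thesis
    using nb even_lattices_mat_act[OF g] unfolding neighbours_def by (blast intro: iso_trans)
qed

lemma vois_mat_act:
  assumes g: "g \<in> O_n"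
  shows "vois A (mat_act g L) = mat_act g ` vois A L"
proof
  show "mat_act g ` vois A L \<subseteq> vois A (mat_act g L)"
    using neighbours_mat_act[OF g] by (auto simp: vois_def)
  show "vois A (mat_act g L) \<subseteq> mat_act g ` vois A L"
  proof
    fix M assume "M \<in> vois A (mat_act g L)"
    hence "mat_act (transpose g) M \<in> vois A L"
      using neighbours_mat_act[OF O_n_transpose[OF g], of A "mat_act g L" M] g by (simp add: vois_def)
    moreover have "M = mat_act g (mat_act (transpose g) M)" using g by simp
    ultimately show "M \<in> mat_act g ` vois A L" by blast
  qed
qed

section \<open>Transitivity of the special orthogonal group\<close>

lemma det_Ints:
  fixes M :: "real^'n^'n"
  assumes "\<And>i j. M $ i $ j \<in> \<int>"
  shows "det M \<in> \<int>"
  unfolding det_def using assms by (intro Ints_sum Ints_mult Ints_prod) auto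

lemma gram_matrix_conv: "gram_matrix b = (\<chi> i. b i) ** Finite_Cartesian_Product.transpose (\<chi> i. b i)"
  by (simp add: gram_matrix_def matrix_matrix_mult_def Finite_Cartesian_Product.transpose_def
      vec_eq_iff inner_vec_def)

lemma lattice_basis_change:
  fixes b b' :: "'n \<Rightarrow> real^'n"
  assumes "is_lattice_basis b L" "is_lattice_basis b' L"
  obtains P :: "real^'n^'n" where "det P \<in> \<int>" "(\<chi> i. b' i) = P ** (\<chi> i. b i)"
proof -
  have "\<forall>i. \<exists>c :: 'n \<Rightarrow> int. b' i = (\<Sum>j\<in>UNIV. of_int (c j) *\<^sub>R b j)"
    using lattice_basis_in[OF assms(2)] lattice_basis_mem[OF assms(1)] by blast
  then obtain c :: "'n \<Rightarrow> 'n \<Rightarrow> int" where c: "\<And>i. b' i = (\<Sum>j\<in>UNIV. of_int (c i j) *\<^sub>R b j)"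
    by metis
  show thesis
  proof (rule that)
    show "det (\<chi> i j. real_of_int (c i j)) \<in> \<int>" by (rule det_Ints) simp
    show "(\<chi> i. b' i) = (\<chi> i j. of_int (c i j)) ** (\<chi> i. b i)"
      by (simp add: vec_eq_iff matrix_matrix_mult_def c)
  qed
qed

lemma det_lattice_basis_nz:
  assumes "is_lattice_basis b L"
  shows "det (\<chi> i. b i) \<noteq> 0"
proof -
  have "rows (\<chi> i. b i) = range b" by (auto simp: rows_def row_def)
  hence "\<exists>B. B ** (\<chi> i. b i) = mat 1"
    using lattice_basis_span[OF assms] matrix_left_invertible_span_rows by metis
  thus ?thesis using invertible_det_nz invertible_left_inverse by blast
qed

text \<open>Two bases differ by integral matrices P and Q with \<open>det P * det Q = 1\<close>.
  Hence det P is 1 or -1, and the Gram determinant, which gets multiplied by the square of det P,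
  does not change. This makes the definite description computable from any basis.\<close>

lemma lattice_det_eq:
  fixes b :: "'n \<Rightarrow> real^'n"
  assumes b: "is_lattice_basis b L"
  shows "lattice_det L = det (gram_matrix b)"
proof -
  have "det (gram_matrix b') = det (gram_matrix b)" if b': "is_lattice_basis b' L"
    for b' :: "'n \<Rightarrow> real^'n"
  proof -
    obtain P :: "real^'n^'n" where P: "det P \<in> \<int>" "(\<chi> i. b' i) = P ** (\<chi> i. b i)"
      using lattice_basis_change[OF b b'] .
    obtain Q :: "real^'n^'n" where Q: "det Q \<in> \<int>" "(\<chi> i. b i) = Q ** (\<chi> i. b' i)"
      using lattice_basis_change[OF b' b] .
    have "det (\<chi> i. b i) = det Q * (det P * det (\<chi> i. b i))"
      using P(2) Q(2) by (metis det_mul)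
    hence PQ: "det P * det Q = 1" using det_lattice_basis_nz[OF b] by (simp add: mult_ac)
    obtain p q where pq: "det P = of_int p" "det Q = of_int q" using P(1) Q(1) by (auto elim!: Ints_cases)
    have "p * q = 1" using PQ unfolding pq by (metis of_int_eq_1_iff of_int_mult)
    hence "p = 1 \<or> p = -1" by (rule pos_zmult_eq_1_iff_lemma)
    hence "det P * det P = 1" using pq by auto
    moreover have "det (gram_matrix b') = (det P * det P) * det (gram_matrix b)"
      by (simp add: gram_matrix_conv det_mul P(2) mult_ac)
    ultimately show ?thesis by simp
  qed
  with b show ?thesis unfolding lattice_det_def by (intro the_equality) blast+
qed

lemma is_lattice_basisI_det:
  fixes b :: "'n \<Rightarrow> real^'n"
  assumes "det (\<chi> i. b i) \<noteq> 0" "L = {(\<Sum>i\<in>UNIV. of_int (c i) *\<^sub>R b i) | c. True}"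
  shows "is_lattice_basis b L"
proof -
  have row: "row i (\<chi> i. b i) = b i" for i by (simp add: row_def)
  have "inj b" using assms(1) det_identical_rows[of _ _ "\<chi> i. b i"] by (auto simp: row intro!: injI)
  moreover have "rows (\<chi> i. b i) = range b" by (auto simp: rows_def row)
  hence "independent (range b)" using assms(1) det_dependent_rows[of "\<chi> i. b i"]
    by (auto simp: dependent_vec_eq)
  ultimately show ?thesis using assms(2) unfolding is_lattice_basis_def by blast
qed

lemma is_lattice_basis_integral:
  fixes b :: "'n \<Rightarrow> real^'n"
  assumes b: "is_lattice_basis b L" and int: "\<And>i j. b i \<bullet> b j \<in> \<int>"
    and xy: "x \<in> L" "y \<in> L"
  shows "x \<bullet> y \<in> \<int>"
proof -
  obtain c d where "x = (\<Sum>i\<in>UNIV. of_int (c i) *\<^sub>R b i)" "y = (\<Sum>i\<in>UNIV. of_int (d i) *\<^sub>R b i)"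
    using xy lattice_basis_mem[OF b] by blast
  thus ?thesis using int
    by (auto simp: inner_sum_left inner_sum_right intro!: Ints_mult Ints_sum)
qed

text \<open>The square norm of u + v is the sum of the square norms plus twice the integer
  \<open>u \<bullet> v\<close>, so evenness passes from the basis vectors to partial sums of the
  expansion of x.\<close>

lemma is_lattice_basis_even:
  fixes b :: "'n \<Rightarrow> real^'n"
  assumes b: "is_lattice_basis b L" and int: "\<And>i j. b i \<bullet> b j \<in> \<int>"
    and even: "\<And>i. \<exists>k::int. b i \<bullet> b i = 2 * of_int k" and x: "x \<in> L"
  shows "\<exists>k::int. x \<bullet> x = 2 * of_int k"
proof -
  have lat: "is_lattice L" using b is_lattice_def by blast
  obtain c where c: "x = (\<Sum>i\<in>UNIV. of_int (c i) *\<^sub>R b i)"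
    using x lattice_basis_mem[OF b] by blast
  define f where "f i = of_int (c i) *\<^sub>R b i" for i
  have f: "f i \<in> L" for i
    unfolding f_def by (intro is_lattice_scaleR_int lat lattice_basis_in b)
  have "\<exists>k::int. (\<Sum>i\<in>I. f i) \<bullet> (\<Sum>i\<in>I. f i) = 2 * of_int k" for I
  proof (induction I rule: infinite_finite_induct)
    case (insert i I)
    obtain k :: int where k: "(\<Sum>i\<in>I. f i) \<bullet> (\<Sum>i\<in>I. f i) = 2 * of_int k" using insert.IH by blast
    obtain m :: int where m: "b i \<bullet> b i = 2 * of_int m" using even by blast
    have "f i \<bullet> (\<Sum>i\<in>I. f i) \<in> \<int>"
      by (rule is_lattice_basis_integral[OF b int f is_lattice_sum[OF lat f]])
    then obtain l :: int where l: "f i \<bullet> (\<Sum>i\<in>I. f i) = of_int l" by (elim Ints_cases)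
    have "f i \<bullet> f i = 2 * of_int (c i * c i * m)" by (simp add: f_def m)
    hence "(\<Sum>i\<in>insert i I. f i) \<bullet> (\<Sum>i\<in>insert i I. f i) = 2 * of_int (c i * c i * m + l + k)"
      using insert.hyps k l by (simp add: inner_add_left inner_add_right inner_commute)
    thus ?case by blast
  qed (auto intro: exI[of _ 0])
  thus ?thesis unfolding c f_def .
qed

section \<open>The lattice \<open>D\<^sub>n\<^sup>+\<close> and its transposition symmetry\<close>

text \<open>A basis of the lattice \<open>D\<^sub>n\<^sup>+\<close>, which is even and unimodular when n is divisible by 8;
  q and l are two distinct coordinates.\<close>

definition Dn_plus_basis :: "'n::finite \<Rightarrow> 'n \<Rightarrow> 'n \<Rightarrow> real^'n" where
  "Dn_plus_basis q l i =
    (if i = q then 2 *\<^sub>R axis q 1 else if i = l then (\<chi> k. 1 / 2) else axis i 1 - axis q 1)"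

definition Dn_plus :: "'n::finite \<Rightarrow> 'n \<Rightarrow> (real^'n) set" where
  "Dn_plus q l = {(\<Sum>i\<in>UNIV. of_int (c i) *\<^sub>R Dn_plus_basis q l i) | c. True}"

text \<open>Only the identity contributes to the Leibniz sum. Row q is supported at q, so a
  contributing p fixes q; a row other than q and l is supported at its own index and q, so p fixes
  that index as well; then l is forced. The diagonal entries other than 1 are 2 and 1/2.\<close>

lemma det_Dn_plus_basis:
  fixes q :: "'n::finite"
  assumes "q \<noteq> l"
  shows "det (\<chi> i. Dn_plus_basis q l i) = 1"
proof -
  define M :: "real^'n^'n" where "M = (\<chi> i. Dn_plus_basis q l i)"
  have M: "M $ i $ j = (if i = q then if j = q then 2 else 0 else if i = l then 1 / 2
      else if j = i then 1 else if j = q then -1 else 0)" for i j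
    by (auto simp: M_def Dn_plus_basis_def axis_def)
  have "(\<Prod>i\<in>UNIV. M $ i $ p i) = 0" if p: "p permutes UNIV" "p \<noteq> id" for p
  proof (rule ccontr)
    assume "(\<Prod>i\<in>UNIV. M $ i $ p i) \<noteq> 0"
    hence nz: "M $ i $ p i \<noteq> 0" for i by simp
    have inj: "inj p" using p(1) by (rule permutes_inj)
    have q: "p q = q" using nz[of q] by (auto simp: M split: if_splits)
    have i: "p i = i" if "i \<noteq> l" for i
      using nz[of i] that q injD[OF inj, of i q] by (auto simp: M split: if_splits)
    have "p l = l" using i injD[OF inj, of "p l" l] by blast
    with i have "p = id" by (intro ext) (metis id_apply)
    thus False using p(2) by blast
  qed
  hence "det M = (\<Sum>p\<in>{id}. of_int (sign p) * (\<Prod>i\<in>UNIV. M $ i $ p i))"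
    unfolding det_def
    by (intro sum.mono_neutral_right) (auto simp: permutes_id)
  also have "\<dots> = (\<Prod>i\<in>UNIV. (if i = q then 2 else 1) * (if i = l then 1 / 2 else 1))"
    using assms by (auto simp: M intro!: prod.cong)
  also have "\<dots> = 1" by (simp add: prod.distrib)
  finally show ?thesis by (simp add: M_def)
qed

lemma is_lattice_basis_Dn_plus:
  fixes q :: "'n::finite"
  assumes "q \<noteq> l"
  shows "is_lattice_basis (Dn_plus_basis q l) (Dn_plus q l)"
  by (rule is_lattice_basisI_det) (simp_all add: det_Dn_plus_basis[OF assms] Dn_plus_def)

text \<open>Integrality and evenness are checked on the basis. Divisibility of n by 8 enters through
  the vector with all coordinates 1/2, whose square norm is n/4. The remaining basis vectors have
  square norm 4 (index q) or 2.\<close>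

lemma Dn_plus_even_lattice:
  fixes q :: "'n::finite"
  assumes "q \<noteq> l" "CARD('n) mod 8 = 0"
  shows "Dn_plus q l \<in> even_lattices"
proof -
  obtain m where m: "CARD('n) = 8 * m" using assms(2) by auto
  have half: "(\<chi> k. 1 / 2) \<bullet> ((\<chi> k. 1 / 2) :: real^'n) = 2 * of_nat m"
    unfolding inner_vec_def by (simp add: m)
  have ax: "axis i (1::real) \<bullet> axis j 1 = (if i = j then 1 else 0)" for i j :: 'n
    by (simp add: inner_axis_axis)
  have half_ax: "((\<chi> k. 1 / 2) :: real^'n) \<bullet> axis j (1::real) = 1 / 2"
    "axis j (1::real) \<bullet> ((\<chi> k. 1 / 2) :: real^'n) = 1 / 2" for j :: 'n
    by (simp_all add: inner_axis inner_axis')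
  note basis = is_lattice_basis_Dn_plus[OF assms(1)]
  have int: "Dn_plus_basis q l i \<bullet> Dn_plus_basis q l j \<in> \<int>" for i j
    by (auto simp: Dn_plus_basis_def inner_diff_left inner_diff_right half ax half_ax)
  have ev: "\<exists>k::int. Dn_plus_basis q l i \<bullet> Dn_plus_basis q l i = 2 * of_int k" for i
  proof -
    have "Dn_plus_basis q l i \<bullet> Dn_plus_basis q l i =
        2 * of_int (if i = q then 2 else if i = l then int m else 1)"
      using assms(1) by (auto simp: Dn_plus_basis_def inner_diff_left inner_diff_right half ax half_ax)
    thus ?thesis by blast
  qed
  have "lattice_det (Dn_plus q l) = 1"
    by (simp add: lattice_det_eq[OF basis] gram_matrix_conv det_mul det_Dn_plus_basis[OF assms(1)])
  moreover have "even CARD('n)" using m by simp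
  ultimately have "lattice_det (Dn_plus q l) = (if even CARD('n) then 1 else 2)" by (simp only: if_True)
  moreover have "is_lattice (Dn_plus q l)" using basis is_lattice_def by blast
  ultimately show ?thesis
    unfolding even_lattices_def
    using is_lattice_basis_integral[OF basis int] is_lattice_basis_even[OF basis int ev]
    by (intro CollectI conjI ballI)
qed

text \<open>Transposing two coordinates i and j different from q and l swaps the basis vectors with
  indices i and j and fixes all others, so the lattice is preserved. Since n is at least 8, such i
  and j exist.\<close>

lemma Dn_plus_reflection:
  fixes q :: "'n::finite"
  assumes "q \<noteq> l" "CARD('n) mod 8 = 0"
  obtains s :: "real^'n^'n" where "s \<in> O_n" "det s = -1" "mat_act s (Dn_plus q l) = Dn_plus q l"
proof -
  have "card {q, l} \<le> 2" by (simp add: card_insert_if)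
  moreover have "CARD('n) \<ge> 8" using assms(2) dvd_imp_le[of 8 "CARD('n)"] by (auto simp: mod_eq_0_iff_dvd)
  ultimately have "card (UNIV - {q, l}) \<ge> 2" by (subst card_Diff_subset) auto
  then obtain i j where ij: "i \<noteq> j" "i \<notin> {q, l}" "j \<notin> {q, l}"
    by (auto simp: numeral_2_eq_2 card_le_Suc_iff)
  define \<tau> where "\<tau> = Transposition.transpose i j"
  have tau: "\<tau> permutes UNIV" "\<tau> (\<tau> k) = k" "sign \<tau> = -1" for k
    using ij(1) by (simp_all add: \<tau>_def permutes_swap_id sign_swap_id)
  \<comment> \<open>The permutation matrix of \<tau>, written as permuted rows of the identity so
    that its determinant is the sign of \<tau>.\<close>
  define s :: "real^'n^'n" where "s = (\<chi> k. mat 1 $ \<tau> k)"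
  have s: "(s *v x) $ k = x $ \<tau> k" for x k
  proof -
    have "(s *v x) $ k = (mat 1 *v x) $ \<tau> k" by (simp add: s_def matrix_vector_mult_def)
    thus ?thesis by simp
  qed
  have ss: "s *v (s *v x) = x" for x by (simp add: vec_eq_iff s tau)
  have det: "det s = -1"
    unfolding s_def using det_permute_rows[OF tau(1), of "mat 1 :: real^'n^'n"] tau(3) by simp
  have sO: "s \<in> O_n"
  proof -
    have "(s *v x) \<bullet> (s *v y) = x \<bullet> y" for x y
      unfolding inner_vec_def s
      by (rule sum.reindex_bij_betw[OF permutes_imp_bij[OF tau(1)]])
    hence "orthogonal_transformation ((*v) s)"
      by (simp add: orthogonal_transformation_def matrix_vector_mul_linear)
    thus ?thesis by (simp add: O_n_def orthogonal_transformation_matrix)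
  qed
  have "mat_act s (Dn_plus q l) = Dn_plus q l"
  proof -
    note basis = is_lattice_basis_Dn_plus[OF assms(1)]
    have lat: "is_lattice (Dn_plus q l)" using basis is_lattice_def by blast
    have sb: "s *v Dn_plus_basis q l k = Dn_plus_basis q l (\<tau> k)" for k
      using ij by (auto simp: vec_eq_iff s Dn_plus_basis_def axis_def \<tau>_def Transposition.transpose_def)
    have sub: "s *v x \<in> Dn_plus q l" if x: "x \<in> Dn_plus q l" for x
    proof -
      obtain c where "x = (\<Sum>i\<in>UNIV. of_int (c i) *\<^sub>R Dn_plus_basis q l i)"
        using x by (auto simp: Dn_plus_def)
      hence "s *v x = (\<Sum>i\<in>UNIV. of_int (c i) *\<^sub>R Dn_plus_basis q l (\<tau> i))"
        by (simp add: linear_sum[OF matrix_vector_mul_linear] matrix_vector_mult_scaleR sb)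
      thus ?thesis
        by (simp add: is_lattice_sum[OF lat] is_lattice_scaleR_int[OF lat] lattice_basis_in[OF basis])
    qed
    show ?thesis unfolding mat_act_def
    proof (intro equalityI subsetI)
      show "x \<in> (*v) s ` Dn_plus q l" if "x \<in> Dn_plus q l" for x
        using sub[OF that] ss[of x] by (metis image_eqI)
    qed (use sub in blast)
  qed
  with sO det show thesis by (rule that)
qed

section \<open>From one orbit of \<open>O_n\<close> to one orbit of \<open>SO_n\<close>\<close>

lemma even_lattices_O_n_transitive:
  assumes "card (X_n :: (real^'n) set set set) = 1"
    and "L \<in> even_lattices" "(L' :: (real^'n) set) \<in> even_lattices"
  obtains g where "g \<in> O_n" "mat_act g L = L'"
proof -
  let ?orb = "orbit (matrix_monoid O_n) mat_act"
  obtain X where X: "(X_n :: (real^'n) set set set) = {X}" using assms(1) by (auto simp: card_1_singleton_iff)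
  have "?orb L \<in> X_n" "?orb L' \<in> X_n" using assms(2,3) by (auto simp: X_n_def orbits_def)
  hence "?orb L = ?orb L'" using X by auto
  moreover have "L' \<in> ?orb L'"
    using SO_n_one SO_n_subset_O_n
    by (auto simp: orbit_def matrix_monoid_def intro!: exI[of _ "mat 1"])
  ultimately have "L' \<in> ?orb L" by simp
  thus thesis using that by (auto simp: orbit_def matrix_monoid_def)
qed

lemma even_lattice_improper_automorphism:
  assumes n: "CARD('n) mod 8 \<in> {0, 1, 7}"
    and X: "card (X_n :: (real^'n) set set set) = 1"
    and L: "(L :: (real^'n) set) \<in> even_lattices"
  obtains s where "s \<in> O_n" "det s = -1" "mat_act s L = L"
proof (cases "even CARD('n)")
  case True
  have "c mod 8 \<noteq> 1" "c mod 8 \<noteq> 7" if "even c" for c :: nat using that by presburger+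
  hence n: "CARD('n) mod 8 = 0" using n True by blast
  have "CARD('n) \<noteq> 0" by simp
  hence "\<not> CARD('n) \<le> Suc 0" using n by (auto simp: le_Suc_eq)
  then obtain q l :: 'n where ol: "q \<noteq> l" by (subst (asm) card_le_Suc0_iff_eq) auto
  obtain s :: "real^'n^'n" where s: "s \<in> O_n" "det s = -1" "mat_act s (Dn_plus q l) = Dn_plus q l"
    using Dn_plus_reflection[OF ol n] .
  obtain k where k: "k \<in> O_n" "mat_act k L = Dn_plus q l"
    using even_lattices_O_n_transitive[OF X L Dn_plus_even_lattice[OF ol n]] .
  \<comment> \<open>The symmetry s of \<open>Dn_plus q l\<close> is transported to L by conjugating
    with the isometry k; conjugation keeps the determinant.\<close>
  let ?kt = "Finite_Cartesian_Product.transpose k"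
  show thesis
  proof (rule that)
    show "?kt ** (s ** k) \<in> O_n" using s k by (intro O_n_mult O_n_transpose)
    have "det ?kt * det k = 1"
      using O_n_transpose_mult(1)[OF k(1)] by (metis det_I det_mul)
    thus "det (?kt ** (s ** k)) = -1" by (simp add: det_mul s(2) mult_ac)
    show "mat_act (?kt ** (s ** k)) L = L"
      using k s by (metis mat_act_mult mat_act_transpose(1))
  qed
next
  case False
  show thesis
  proof (rule that)
    \<comment> \<open>For n odd the witness is -1, which preserves every lattice and has determinant
      (-1)^n = -1.\<close>
    have neg: "mat (-1) *v x = - x" for x :: "real^'n"
      by (simp add: vec_eq_iff matrix_vector_mult_def mat_def if_distrib[of "\<lambda>a. a * _"] cong: if_cong)
    have "orthogonal_transformation ((*v) (mat (-1) :: real^'n^'n))"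
      unfolding orthogonal_transformation_def by (simp only: matrix_vector_mul_linear neg) simp
    thus "mat (-1) \<in> (O_n :: (real^'n^'n) set)"
      by (simp add: O_n_def orthogonal_transformation_matrix)
    have "det (mat (-1) :: real^'n^'n) = (\<Prod>i\<in>(UNIV :: 'n set). -1)"
      by (subst det_diagonal) (simp_all add: mat_def)
    thus "det (mat (-1) :: real^'n^'n) = -1" using False by simp
    have "is_lattice L" using L by (simp add: even_lattices_def)
    note um = is_lattice_uminus[OF this]
    show "mat_act (mat (-1)) L = L"
      unfolding mat_act_def neg
    proof (intro equalityI subsetI)
      show "x \<in> uminus ` L" if "x \<in> L" for x using um[OF that] by (intro image_eqI[of _ _ "- x"]) auto
    qed (use um in blast)
  qed
qed

lemma even_lattices_SO_n_transitive:
  assumes n: "CARD('n) mod 8 \<in> {0, 1, 7}"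
    and X: "card (X_n :: (real^'n) set set set) = 1"
    and L: "L \<in> even_lattices" "(L' :: (real^'n) set) \<in> even_lattices"
  obtains g where "g \<in> SO_n" "mat_act g L = L'"
proof -
  obtain g where g: "g \<in> O_n" "mat_act g L = L'"
    using even_lattices_O_n_transitive[OF X L] .
  obtain s where s: "s \<in> O_n" "det s = -1" "mat_act s L = L"
    using even_lattice_improper_automorphism[OF n X L(1)] .
  consider "det g = 1" | "det g = -1" using g(1) det_orthogonal_matrix by (auto simp: O_n_def)
  thus thesis
  proof cases
    case 1
    thus thesis using g by (intro that) (auto simp: SO_n_def O_n_def rotation_matrix_def)
  next
    \<comment> \<open>Composing on the right with s corrects the sign of the determinant and still
      sends L to L', because s fixes L.\<close>
    case 2
    moreover have "g ** s \<in> O_n" using g(1) s(1) by (rule O_n_mult)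
    ultimately show thesis using g s
      by (intro that[of "g ** s"]) (auto simp: SO_n_def O_n_def rotation_matrix_def det_mul mat_act_mult)
  qed
qed

section \<open>The Hecke operator\<close>

text \<open>Double counting: the sum over S is k times the sum over the image, and card S is k times
  the size of the image. Cross-multiplying eliminates k. In the application S is
  \<open>SO_lattice L\<close>, h is an orbit map and k is the order of a stabiliser.\<close>

lemma (in vector_space) sum_fibres_scale:
  assumes "finite S" "\<And>y. y \<in> h ` S \<Longrightarrow> card {x \<in> S. h x = y} = k"
  shows "scale (of_nat (card S)) (\<Sum>y\<in>h ` S. F y) = scale (of_nat (card (h ` S))) (\<Sum>x\<in>S. F (h x))"
proof -
  have const: "(\<Sum>x\<in>T. y) = scale (of_nat (card T)) y" if "finite T" for T :: "'x set" and y
    using that by induction (auto simp: scale_left_distrib)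
  have "(\<Sum>x\<in>S. F (h x)) = (\<Sum>y\<in>h ` S. \<Sum>x\<in>{x \<in> S. h x = y}. F (h x))"
    by (rule sum.image_gen) fact
  also have "\<dots> = (\<Sum>y\<in>h ` S. scale (of_nat k) (F y))"
  proof (rule sum.cong)
    show "(\<Sum>x\<in>{x \<in> S. h x = y}. F (h x)) = scale (of_nat k) (F y)" if "y \<in> h ` S" for y
    proof -
      have "(\<Sum>x\<in>{x \<in> S. h x = y}. F (h x)) = (\<Sum>x\<in>{x \<in> S. h x = y}. F y)" by (rule sum.cong) auto
      thus ?thesis using const[of "{x \<in> S. h x = y}" "F y"] assms that by simp
    qed
  qed simp
  finally have sum: "(\<Sum>x\<in>S. F (h x)) = scale (of_nat k) (\<Sum>y\<in>h ` S. F y)"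
    by (simp add: scale_sum_right)
  have "card S = (\<Sum>y\<in>h ` S. card {x \<in> S. h x = y})"
    using sum.image_gen[OF assms(1), of "\<lambda>_. 1 :: nat" h] by simp
  also have "\<dots> = card (h ` S) * k" using assms(2) by simp
  finally show ?thesis by (simp add: sum)
qed

section \<open>Orbits of the finite group \<open>SO_lattice L\<close> on neighbours\<close>

lemma SO_lattice_mult: "\<gamma> \<in> SO_lattice L \<Longrightarrow> \<delta> \<in> SO_lattice L \<Longrightarrow> \<gamma> ** \<delta> \<in> SO_lattice L"
  by (simp add: SO_lattice_def SO_n_mult mat_act_mult)

lemma SO_lattice_one: "mat 1 \<in> SO_lattice L"
  by (simp add: SO_lattice_def)

lemma SO_lattice_transpose: "\<gamma> \<in> SO_lattice L \<Longrightarrow> Finite_Cartesian_Product.transpose \<gamma> \<in> SO_lattice L"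
  using SO_n_subset_O_n mat_act_transpose(1)[of \<gamma> L] by (auto simp: SO_lattice_def SO_n_transpose)

lemma SO_lattice_subset: "SO_lattice L \<subseteq> SO_n"
  by (auto simp: SO_lattice_def)

lemma SO_lattice_mult_image:
  assumes "\<delta> \<in> SO_lattice L"
  shows "bij_betw ((**) \<delta>) (SO_lattice L) (SO_lattice L)"
proof (rule bij_betw_byWitness[where f' = "(**) (Finite_Cartesian_Product.transpose \<delta>)"])
  have "\<delta> \<in> O_n" using assms SO_lattice_subset SO_n_subset_O_n by blast
  note O_n_transpose_mult[OF this]
  thus "\<forall>\<gamma>\<in>SO_lattice L. Finite_Cartesian_Product.transpose \<delta> ** (\<delta> ** \<gamma>) = \<gamma>"
    "\<forall>\<gamma>\<in>SO_lattice L. \<delta> ** (Finite_Cartesian_Product.transpose \<delta> ** \<gamma>) = \<gamma>"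
    by (simp_all add: matrix_mul_assoc)
qed (use assms SO_lattice_mult SO_lattice_transpose in blast)+

lemma vois_orbits_eq:
  "vois_orbits A L = (\<lambda>M. (\<lambda>\<gamma>. mat_act \<gamma> M) ` SO_lattice L) ` vois A L"
  by (auto simp: vois_orbits_def orbits_def orbit_def matrix_monoid_def)

text \<open>Any member can serve as base point of its orbit. This allows the base point
  \<open>mat_act (g V) L\<close> prescribed by g, and also shows that distinct orbits are
  disjoint.\<close>

lemma vois_orbit_eq:
  assumes "V \<in> vois_orbits A L" "M \<in> V"
  shows "V = (\<lambda>\<gamma>. mat_act \<gamma> M) ` SO_lattice L"
proof -
  obtain N where V: "V = (\<lambda>\<gamma>. mat_act \<gamma> N) ` SO_lattice L" using assms(1) by (auto simp: vois_orbits_eq)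
  obtain \<delta> where \<delta>: "\<delta> \<in> SO_lattice L" "M = mat_act \<delta> N" using assms(2) V by blast
  have "\<delta> \<in> O_n" using \<delta>(1) SO_lattice_subset SO_n_subset_O_n by blast
  hence N: "N = mat_act (Finite_Cartesian_Product.transpose \<delta>) M" using \<delta>(2) by simp
  have "mat_act \<gamma> N = mat_act (\<gamma> ** Finite_Cartesian_Product.transpose \<delta>) M" for \<gamma>
    unfolding N by (simp add: mat_act_mult)
  moreover have "mat_act \<gamma> M = mat_act (\<gamma> ** \<delta>) N" for \<gamma>
    unfolding \<delta>(2) by (simp add: mat_act_mult)
  moreover have "\<gamma> ** Finite_Cartesian_Product.transpose \<delta> \<in> SO_lattice L" "\<gamma> ** \<delta> \<in> SO_lattice L"
    if "\<gamma> \<in> SO_lattice L" for \<gamma>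
    using that \<delta>(1) SO_lattice_mult SO_lattice_transpose by blast+
  ultimately show ?thesis unfolding V by blast
qed

lemma vois_subset: "vois A L \<subseteq> even_lattices"
  by (auto simp: vois_def neighbours_def)

lemma Union_vois_orbits: "\<Union> (vois_orbits A L) = vois A L"
proof
  show "\<Union> (vois_orbits A L) \<subseteq> vois A L"
  proof
    fix M assume "M \<in> \<Union> (vois_orbits A L)"
    then obtain N \<gamma> where N: "N \<in> vois A L" "\<gamma> \<in> SO_lattice L" "M = mat_act \<gamma> N"
      by (auto simp: vois_orbits_eq)
    have "\<gamma> \<in> O_n" "mat_act \<gamma> L = L" using N(2) SO_n_subset_O_n by (auto simp: SO_lattice_def)
    thus "M \<in> vois A L" using vois_mat_act[of \<gamma> A L] N by auto
  qed
  show "vois A L \<subseteq> \<Union> (vois_orbits A L)"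
  proof
    fix M assume "M \<in> vois A L"
    moreover have "M \<in> (\<lambda>\<gamma>. mat_act \<gamma> M) ` SO_lattice L"
      using SO_lattice_one by (rule image_eqI[rotated]) simp
    ultimately show "M \<in> \<Union> (vois_orbits A L)" by (auto simp: vois_orbits_eq)
  qed
qed

text \<open>Left multiplication by \<delta> maps the stabiliser of M bijectively onto the elements
  sending M to \<delta> M; so all fibres of the orbit map have equal size.\<close>

lemma card_orbit_fibre:
  assumes "\<delta> \<in> SO_lattice L" "finite (SO_lattice L)"
  shows "card {\<gamma> \<in> SO_lattice L. mat_act \<gamma> M = mat_act \<delta> M} = card {\<gamma> \<in> SO_lattice L. mat_act \<gamma> M = M}"
proof (rule sym, rule bij_betw_same_card)
  have \<delta>: "\<delta> \<in> O_n" using assms(1) SO_lattice_subset SO_n_subset_O_n by blast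
  have "mat_act \<gamma> M = M \<longleftrightarrow> mat_act (\<delta> ** \<gamma>) M = mat_act \<delta> M" for \<gamma>
    using \<delta> by (metis mat_act_mult mat_act_transpose(1))
  thus "bij_betw ((**) \<delta>) {\<gamma> \<in> SO_lattice L. mat_act \<gamma> M = M} {\<gamma> \<in> SO_lattice L. mat_act \<gamma> M = mat_act \<delta> M}"
    using SO_lattice_mult_image[OF assms(1)] unfolding bij_betw_def
    by (auto simp: inj_on_def image_iff)
qed

section \<open>Equivariant functions and the Hecke action\<close>

lemma is_SO_rep_mult: "is_SO_rep sm \<rho> \<Longrightarrow> g \<in> SO_n \<Longrightarrow> h \<in> SO_n \<Longrightarrow> \<rho> (g ** h) w = \<rho> g (\<rho> h w)"
  by (simp add: is_SO_rep_def)

lemma is_SO_rep_linear: "is_SO_rep sm \<rho> \<Longrightarrow> g \<in> SO_n \<Longrightarrow> Vector_Spaces.linear sm sm (\<rho> g)"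
  by (simp add: is_SO_rep_def)

lemma M_W_apply: "f \<in> M_W \<rho> \<Longrightarrow> g \<in> SO_n \<Longrightarrow> L \<in> even_lattices \<Longrightarrow> f (mat_act g L) = \<rho> g (f L)"
  by (simp add: M_W_def)

lemma vector_space_fun_scale:
  assumes "vector_space sm"
  shows "vector_space (fun_scale sm)"
proof -
  interpret vector_space sm by fact
  show ?thesis
    by unfold_locales (auto simp: fun_scale_def scale_right_distrib scale_left_distrib)
qed

lemma subspace_M_W:
  assumes "vector_space sm" "is_SO_rep sm \<rho>"
  shows "module.subspace (fun_scale sm) (M_W \<rho>)"
proof -
  interpret vector_space sm by fact
  interpret F: vector_space "fun_scale sm" by (rule vector_space_fun_scale) fact
  note lin = is_SO_rep_linear[OF assms(2)]
  have "\<rho> g 0 = 0" "\<rho> g (x + y) = \<rho> g x + \<rho> g y" "\<rho> g (sm c x) = sm c (\<rho> g x)"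
    if "g \<in> SO_n" for g x y c
  proof -
    interpret Vector_Spaces.linear sm sm "\<rho> g" using that by (rule lin)
    show "\<rho> g 0 = 0" "\<rho> g (x + y) = \<rho> g x + \<rho> g y" "\<rho> g (sm c x) = sm c (\<rho> g x)"
      by (rule zero add scale)+
  qed
  thus ?thesis
    by (auto simp: F.subspace_def M_W_def fun_scale_def)
qed

text \<open>The neighbours of g L are the images under g of the neighbours of L, so reindexing the
  Hecke sum moves g onto L', where equivariance of f and linearity of \<rho> g pull it out.\<close>

lemma hecke_T_mat_act:
  assumes sm: "is_SO_rep sm \<rho>" and f: "f \<in> M_W \<rho>" and g: "g \<in> SO_n"
  shows "hecke_T A f (mat_act g L) = \<rho> g (hecke_T A f L)"
proof -
  interpret Vector_Spaces.linear sm sm "\<rho> g" using sm g by (rule is_SO_rep_linear)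
  have gO: "g \<in> O_n" using g SO_n_subset_O_n by blast
  have "inj_on (mat_act g) (vois A L)"
    using mat_act_transpose(1)[OF gO] by (metis inj_on_inverseI)
  hence "hecke_T A f (mat_act g L) = (\<Sum>M\<in>vois A L. f (mat_act g M))"
    by (simp add: hecke_T_def vois_mat_act[OF gO] sum.reindex)
  also have "\<dots> = (\<Sum>M\<in>vois A L. \<rho> g (f M))"
    using M_W_apply[OF f g] vois_subset by (intro sum.cong) auto
  finally show ?thesis by (simp add: hecke_T_def sum)
qed

text \<open>The operator \<open>\<Theta>\<close> of the outline, with the orbit set and the choice
  of representatives as parameters. Its trace on W is the right-hand side of the trace
  formula.\<close>

definition hecke_average ::
    "(complex \<Rightarrow> 'w::ab_group_add \<Rightarrow> 'w) \<Rightarrow> (real^'n^'n \<Rightarrow> 'w \<Rightarrow> 'w) \<Rightarrow> (real^'n) set \<Rightarrow>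
     (real^'n) set set set \<Rightarrow> ((real^'n) set set \<Rightarrow> real^'n^'n) \<Rightarrow> 'w \<Rightarrow> 'w" where
  "hecke_average sm \<rho> L \<V> g w =
    (\<Sum>V\<in>\<V>. sm (of_nat (card V) / of_nat (card (SO_lattice L))) (\<Sum>\<gamma>\<in>SO_lattice L. \<rho> (\<gamma> ** g V) w))"

text \<open>The Hecke sum at L is split over the orbits V. On each orbit, summing over lattices is
  the same as summing over the group acting on the base point and rescaling by card V over the group
  order; equivariance then expresses every term through f L.\<close>

lemma hecke_T_eq_average:
  fixes L :: "(real^'n) set"
  assumes sm: "vector_space sm" and rep: "is_SO_rep sm \<rho>" and f: "f \<in> M_W \<rho>"
    and L: "L \<in> even_lattices" and fin: "finite (vois A L)"
    and g: "\<And>V. V \<in> vois_orbits A L \<Longrightarrow> g V \<in> SO_n \<and> mat_act (g V) L \<in> V"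
  shows "hecke_T A f L = hecke_average sm \<rho> L (vois_orbits A L) g (f L)"
proof -
  interpret vector_space sm by fact
  let ?G = "SO_lattice L"
  have finG: "finite ?G" using L by (rule finite_SO_lattice)
  have card0: "card ?G \<noteq> 0" using finG SO_lattice_one[of L] by auto
  have "hecke_T A f L = (\<Sum>M\<in>\<Union> (vois_orbits A L). f M)"
    by (simp add: hecke_T_def Union_vois_orbits)
  also have "\<dots> = (\<Sum>V\<in>vois_orbits A L. \<Sum>M\<in>V. f M)"
  proof (rule sum.Union_disjoint[unfolded o_def])
    show "\<forall>V\<in>vois_orbits A L. finite V"
      using finG by (auto simp: vois_orbits_eq)
    show "\<forall>V\<in>vois_orbits A L. \<forall>V'\<in>vois_orbits A L. V \<noteq> V' \<longrightarrow> V \<inter> V' = {}"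
      using vois_orbit_eq by (metis disjoint_iff)
  qed
  also have "\<dots> = hecke_average sm \<rho> L (vois_orbits A L) g (f L)"
    unfolding hecke_average_def
  proof (rule sum.cong)
    fix V assume V: "V \<in> vois_orbits A L"
    let ?M = "mat_act (g V) L"
    have V_eq: "V = (\<lambda>\<gamma>. mat_act \<gamma> ?M) ` ?G" using V g by (intro vois_orbit_eq) auto
    have gV: "g V \<in> SO_n" using g V by blast
    have "card {\<gamma> \<in> ?G. mat_act \<gamma> ?M = N} = card {\<gamma> \<in> ?G. mat_act \<gamma> ?M = ?M}"
      if "N \<in> (\<lambda>\<gamma>. mat_act \<gamma> ?M) ` ?G" for N
      using that card_orbit_fibre[OF _ finG] by blast
    from sum_fibres_scale[OF finG this, of f]
    have "sm (of_nat (card ?G)) (\<Sum>M\<in>V. f M) = sm (of_nat (card V)) (\<Sum>\<gamma>\<in>?G. f (mat_act \<gamma> ?M))"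
      by (simp flip: V_eq)
    also have "(\<Sum>\<gamma>\<in>?G. f (mat_act \<gamma> ?M)) = (\<Sum>\<gamma>\<in>?G. \<rho> (\<gamma> ** g V) (f L))"
    proof (rule sum.cong)
      fix \<gamma> assume "\<gamma> \<in> ?G"
      hence "\<gamma> ** g V \<in> SO_n" using gV SO_lattice_subset SO_n_mult by blast
      from M_W_apply[OF f this L] show "f (mat_act \<gamma> ?M) = \<rho> (\<gamma> ** g V) (f L)"
        by (simp add: mat_act_mult)
    qed simp
    finally have "sm (1 / of_nat (card ?G)) (sm (of_nat (card ?G)) (\<Sum>M\<in>V. f M)) =
        sm (1 / of_nat (card ?G)) (sm (of_nat (card V)) (\<Sum>\<gamma>\<in>?G. \<rho> (\<gamma> ** g V) (f L)))" by simp
    thus "(\<Sum>M\<in>V. f M) = sm (of_nat (card V) / of_nat (card ?G)) (\<Sum>\<gamma>\<in>?G. \<rho> (\<gamma> ** g V) (f L))"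
      using card0 by simp
  qed simp
  finally show ?thesis .
qed

text \<open>Applying \<rho> \<delta> only permutes the terms of each inner sum, by the translation
  \<gamma> to \<delta> \<gamma>. Invariance of the values is what lets them extend to elements of
  \<open>M_W \<rho>\<close>.\<close>

lemma hecke_average_invariant:
  assumes rep: "is_SO_rep sm \<rho>" and \<delta>: "\<delta> \<in> SO_lattice L" and g: "\<And>V. V \<in> \<V> \<Longrightarrow> g V \<in> SO_n"
  shows "\<rho> \<delta> (hecke_average sm \<rho> L \<V> g w) = hecke_average sm \<rho> L \<V> g w"
proof -
  have \<delta>': "\<delta> \<in> SO_n" using \<delta> SO_lattice_subset by blast
  interpret Vector_Spaces.linear sm sm "\<rho> \<delta>" using rep \<delta>' by (rule is_SO_rep_linear)
  have "(\<Sum>\<gamma>\<in>SO_lattice L. \<rho> \<delta> (\<rho> (\<gamma> ** g V) w)) = (\<Sum>\<gamma>\<in>SO_lattice L. \<rho> (\<gamma> ** g V) w)" if V: "V \<in> \<V>" for V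
  proof -
    have "(\<Sum>\<gamma>\<in>SO_lattice L. \<rho> (\<gamma> ** g V) w) = (\<Sum>\<gamma>\<in>SO_lattice L. \<rho> ((\<delta> ** \<gamma>) ** g V) w)"
      by (rule sum.reindex_bij_betw[symmetric]) (rule SO_lattice_mult_image[OF \<delta>])
    also have "\<dots> = (\<Sum>\<gamma>\<in>SO_lattice L. \<rho> \<delta> (\<rho> (\<gamma> ** g V) w))"
    proof (rule sum.cong)
      fix \<gamma> assume "\<gamma> \<in> SO_lattice L"
      hence "\<gamma> ** g V \<in> SO_n" using g[OF V] SO_lattice_subset SO_n_mult by blast
      from is_SO_rep_mult[OF rep \<delta>' this]
      show "\<rho> ((\<delta> ** \<gamma>) ** g V) w = \<rho> \<delta> (\<rho> (\<gamma> ** g V) w)" by (simp add: matrix_mul_assoc)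
    qed simp
    finally show ?thesis by simp
  qed
  thus ?thesis by (simp add: hecke_average_def sum scale)
qed

lemma linear_hecke_average:
  assumes sm: "vector_space sm" and rep: "is_SO_rep sm \<rho>" and g: "\<And>V. V \<in> \<V> \<Longrightarrow> g V \<in> SO_n"
  shows "Vector_Spaces.linear sm sm (hecke_average sm \<rho> L \<V> g)"
proof -
  interpret vector_space_pair sm sm using sm by (simp add: vector_space_pair_def)
  have "Vector_Spaces.linear sm sm (\<rho> (\<gamma> ** g V))" if "\<gamma> \<in> SO_lattice L" "V \<in> \<V>" for \<gamma> V
    using that g SO_lattice_subset SO_n_mult by (intro is_SO_rep_linear[OF rep]) blast
  thus ?thesis unfolding hecke_average_def
    by (intro linear_compose_sum ballI linear_compose_scale_right) auto
qed

lemma trace_hecke_average: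
  assumes sm: "vector_space sm"
  shows "trace_on sm UNIV (hecke_average sm \<rho> L \<V> g) =
    1 / of_nat (card (SO_lattice L)) *
    (\<Sum>V\<in>\<V>. of_nat (card V) * (\<Sum>\<gamma>\<in>SO_lattice L. trace_on sm UNIV (\<rho> (\<gamma> ** g V))))"
proof -
  interpret vector_space sm by fact
  have "trace_on sm UNIV (\<lambda>w. \<Sum>\<gamma>\<in>SO_lattice L. \<rho> (\<gamma> ** g V) w) =
      (\<Sum>\<gamma>\<in>SO_lattice L. trace_on sm UNIV (\<rho> (\<gamma> ** g V)))" for V
    using trace_on_sum_scale[OF sm subspace_UNIV, of "SO_lattice L" "\<lambda>\<gamma>. \<rho> (\<gamma> ** g V)" "\<lambda>_. 1"] by simp
  thus ?thesis
    using trace_on_sum_scale[OF sm subspace_UNIV, of \<V> "\<lambda>V w. \<Sum>\<gamma>\<in>SO_lattice L. \<rho> (\<gamma> ** g V) w"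
        "\<lambda>V. of_nat (card V) / of_nat (card (SO_lattice L))"]
    by (simp add: hecke_average_def[abs_def] sum_distrib_left)
qed

lemma linear_eval: "vector_space sm \<Longrightarrow> Vector_Spaces.linear (fun_scale sm) sm (\<lambda>f. f x)"
  using vector_space_fun_scale[of sm]
  by (simp add: Vector_Spaces.linear_def module_hom_def module_hom_axioms_def fun_scale_def
      module_iff_vector_space)

lemma trace_hecke_T:
  fixes A :: "('a, 'b) monoid_scheme" and L0 :: "(real^'n) set"
    and sm :: "complex \<Rightarrow> 'w::ab_group_add \<Rightarrow> 'w"
  assumes sm: "finite_dimensional_vector_space sm B0" and rep: "is_SO_rep sm \<rho>"
    and L0: "L0 \<in> even_lattices" and fin: "finite (vois A L0)"
    and trans: "\<And>L. L \<in> even_lattices \<Longrightarrow> \<exists>h\<in>SO_n. mat_act h L0 = L"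
    and g: "\<And>V. V \<in> vois_orbits A L0 \<Longrightarrow> g V \<in> SO_n \<and> mat_act (g V) L0 \<in> V"
  shows "trace_on (fun_scale sm) (M_W \<rho>) (hecke_T A) =
    trace_on sm UNIV (hecke_average sm \<rho> L0 (vois_orbits A L0) g)"
proof -
  interpret W: finite_dimensional_vector_space sm B0 by fact
  interpret F: vector_space "fun_scale sm" by (rule vector_space_fun_scale) unfold_locales
  interpret pair: vector_space_pair "fun_scale sm" sm ..
  note vs = W.vector_space_axioms
  define \<Theta> where "\<Theta> = hecke_average sm \<rho> L0 (vois_orbits A L0) g"
  \<comment> \<open>An arbitrary section of the orbit map of L0. It need not be compatible with the
    group action; the invariance \<open>\<Theta>_inv\<close> compensates for this.\<close>
  obtain h where h: "\<And>L. L \<in> even_lattices \<Longrightarrow> h L \<in> SO_n \<and> mat_act (h L) L0 = L"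
    using trans by metis
  define \<psi> where "\<psi> w L = (if L \<in> even_lattices then \<rho> (h L) (\<Theta> w) else 0)" for w L
  have \<Theta>_inv: "\<rho> \<delta> (\<Theta> w) = \<Theta> w" if "\<delta> \<in> SO_lattice L0" for \<delta> w
    unfolding \<Theta>_def using rep that g by (intro hecke_average_invariant) auto
  have lin\<Theta>: "Vector_Spaces.linear sm sm \<Theta>"
    unfolding \<Theta>_def using vs rep g by (intro linear_hecke_average) auto
  have lin\<psi>: "Vector_Spaces.linear sm (fun_scale sm) \<psi>"
  proof -
    interpret T: Vector_Spaces.linear sm sm \<Theta> by (rule lin\<Theta>)
    have "\<rho> k (x + y) = \<rho> k x + \<rho> k y" "\<rho> k (sm c x) = sm c (\<rho> k x)" if "k \<in> SO_n" for k x y c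
    proof -
      interpret Vector_Spaces.linear sm sm "\<rho> k" using rep that by (rule is_SO_rep_linear)
      show "\<rho> k (x + y) = \<rho> k x + \<rho> k y" "\<rho> k (sm c x) = sm c (\<rho> k x)" by (rule add scale)+
    qed
    thus ?thesis using h
      by unfold_locales (auto simp: \<psi>_def fun_scale_def T.add T.scale)
  qed
  have mem: "\<psi> w \<in> M_W \<rho>" for w
  proof -
    have "\<psi> w (mat_act \<gamma> L) = \<rho> \<gamma> (\<psi> w L)" if \<gamma>: "\<gamma> \<in> SO_n" and L: "L \<in> even_lattices" for \<gamma> L
    proof -
      have \<gamma>L: "mat_act \<gamma> L \<in> even_lattices"
        using \<gamma> L SO_n_subset_O_n by (intro even_lattices_mat_act) auto
      define k where "k = h (mat_act \<gamma> L)"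
      have k: "k \<in> SO_n" "mat_act k L0 = mat_act \<gamma> L" "k \<in> O_n"
        using h[OF \<gamma>L] SO_n_subset_O_n by (auto simp: k_def)
      \<comment> \<open>Both k and \<open>\<gamma> ** h L\<close> carry L0 to \<gamma> L, so they
        differ by an element \<delta> of \<open>SO_lattice L0\<close>, which fixes \<Theta> w. Hence
        \<psi> w is equivariant.\<close>
      define \<delta> where "\<delta> = Finite_Cartesian_Product.transpose k ** (\<gamma> ** h L)"
      have "\<delta> \<in> SO_n" unfolding \<delta>_def using k \<gamma> h[OF L] by (intro SO_n_mult SO_n_transpose) auto
      moreover have "mat_act \<delta> L0 = L0"
        using h[OF L] k by (metis \<delta>_def mat_act_mult mat_act_transpose(1))
      ultimately have \<delta>: "\<delta> \<in> SO_lattice L0" "\<delta> \<in> SO_n" by (auto simp: SO_lattice_def)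
      have "k ** \<delta> = \<gamma> ** h L"
        using O_n_transpose_mult(2)[OF k(3)] by (simp add: \<delta>_def matrix_mul_assoc)
      hence "\<rho> k (\<rho> \<delta> (\<Theta> w)) = \<rho> \<gamma> (\<rho> (h L) (\<Theta> w))"
        using is_SO_rep_mult[OF rep] k(1) \<delta>(2) \<gamma> h[OF L] by metis
      thus ?thesis using L \<gamma>L \<Theta>_inv[OF \<delta>(1)] by (simp add: \<psi>_def k_def)
    qed
    thus ?thesis by (auto simp: M_W_def \<psi>_def)
  qed
  \<comment> \<open>The section may send L0 to a nontrivial element, but that element lies in
    \<open>SO_lattice L0\<close> and so acts trivially on \<Theta> w.\<close>
  have eval: "\<psi> w L0 = \<Theta> w" for w
    using L0 h[OF L0] \<Theta>_inv by (simp add: \<psi>_def SO_lattice_def)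
  have hecke: "hecke_T A f = \<psi> (f L0)" if f: "f \<in> M_W \<rho>" for f
  proof
    fix L
    show "hecke_T A f L = \<psi> (f L0) L"
    proof (cases "L \<in> even_lattices")
      case True
      have "hecke_T A f L = \<rho> (h L) (hecke_T A f L0)"
        using hecke_T_mat_act[OF rep f, of "h L" A L0] h[OF True] by simp
      thus ?thesis using hecke_T_eq_average[OF vs rep f L0 fin g] True by (simp add: \<psi>_def \<Theta>_def)
    next
      case False
      hence "vois A L = {}" by (auto simp: vois_def neighbours_def)
      thus ?thesis using False by (simp add: hecke_T_def \<psi>_def)
    qed
  qed
  note lin_ev = linear_eval[OF vs, of L0]
  have sub: "F.subspace (M_W \<rho>)" using vs rep by (rule subspace_M_W)
  have fin_M: "finite B" if B: "F.independent B" "F.span B = M_W \<rho>" for B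
  proof -
    \<comment> \<open>By transitivity and equivariance, f L0 determines f on all even lattices, and
      f vanishes elsewhere. An independent family spanning \<open>M_W \<rho>\<close> therefore stays
      independent and of equal size in W, which bounds it.\<close>
    have inj: "inj_on (\<lambda>f. f L0) (M_W \<rho>)"
    proof (rule inj_onI, rule ext)
      fix f f' L assume *: "f \<in> M_W \<rho>" "f' \<in> M_W \<rho>" "f L0 = f' L0"
      show "f L = f' L"
      proof (cases "L \<in> even_lattices")
        case True
        thus ?thesis using * h[OF True] M_W_apply[OF _ _ L0] by metis
      qed (use * in \<open>auto simp: M_W_def\<close>)
    qed
    hence "W.independent ((\<lambda>f. f L0) ` B)"
      using B by (intro pair.linear_independent_injective_image lin_ev) auto
    hence "finite ((\<lambda>f. f L0) ` B)" by (rule W.finiteI_independent)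
    moreover have "B \<subseteq> M_W \<rho>" using B(2) F.span_superset by blast
    ultimately show ?thesis using inj by (meson finite_imageD inj_on_subset)
  qed
  have "trace_on (fun_scale sm) (M_W \<rho>) (hecke_T A) =
      trace_on (fun_scale sm) (M_W \<rho>) (\<psi> \<circ> (\<lambda>f. f L0))"
    by (rule trace_on_cong) (use F.vector_space_axioms sub hecke in auto)
  \<comment> \<open>Exchanging the order of the two maps moves the trace from the function space to
    W, where evaluation after \<psi> is \<Theta>.\<close>
  also have "\<dots> = trace_on sm UNIV ((\<lambda>f. f L0) \<circ> \<psi>)"
    by (rule pair.trace_on_commute)
      (use lin_ev lin\<psi> sub mem fin_M W.finiteI_independent in auto)
  finally show ?thesis by (simp add: comp_def eval \<Theta>_def)
qed

theorem proposition1p0p1: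
  fixes A :: "('a, 'b) monoid_scheme"
    and L0 :: "(real^'n) set"
    and smult_W :: "complex \<Rightarrow> 'w::ab_group_add \<Rightarrow> 'w"
    and \<rho> :: "real^'n^'n \<Rightarrow> 'w \<Rightarrow> 'w"
  assumes "CARD('n) mod 8 \<in> {0, 1, 7}"
    and "card (X_n :: (real^'n) set set set) = 1"
    and "fin_dim_space smult_W"
    and "is_SO_rep smult_W \<rho>"
    and "comm_group A" and "finite (carrier A)"
    and "L0 \<in> even_lattices"
  shows "(\<forall>V\<in>vois_orbits A L0. \<exists>g\<in>SO_n. mat_act g L0 \<in> V) \<and>
    (\<forall>g. (\<forall>V\<in>vois_orbits A L0. g V \<in> SO_n \<and> mat_act (g V) L0 \<in> V) \<longrightarrow>
      trace_on (fun_scale smult_W) (M_W \<rho>) (hecke_T A) =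
        1 / of_nat (card (SO_lattice L0)) *
        (\<Sum>V\<in>vois_orbits A L0. of_nat (card V) *
          (\<Sum>\<gamma>\<in>SO_lattice L0. trace_on smult_W UNIV (\<rho> (\<gamma> ** g V)))))"
proof (intro conjI ballI allI impI)
  have trans: "\<exists>h\<in>SO_n. mat_act h L0 = L" if "L \<in> even_lattices" for L
    using even_lattices_SO_n_transitive[OF assms(1,2,7) that] by blast
  show "\<exists>g\<in>SO_n. mat_act g L0 \<in> V" if V: "V \<in> vois_orbits A L0" for V
  proof -
    obtain M where "M \<in> V" using V SO_lattice_one by (auto simp: vois_orbits_eq)
    moreover have "M \<in> even_lattices"
      using V \<open>M \<in> V\<close> Union_vois_orbits[of A L0] vois_subset by blast
    ultimately show ?thesis using trans by blast
  qed
  fix g assume g: "\<forall>V\<in>vois_orbits A L0. g V \<in> SO_n \<and> mat_act (g V) L0 \<in> V"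
  obtain B0 where sm: "finite_dimensional_vector_space smult_W B0"
    using assms(3) by (auto simp: fin_dim_space_def)
  hence vs: "vector_space smult_W" by (simp add: finite_dimensional_vector_space_def)
  show "trace_on (fun_scale smult_W) (M_W \<rho>) (hecke_T A) =
        1 / of_nat (card (SO_lattice L0)) *
        (\<Sum>V\<in>vois_orbits A L0. of_nat (card V) *
          (\<Sum>\<gamma>\<in>SO_lattice L0. trace_on smult_W UNIV (\<rho> (\<gamma> ** g V))))"
    unfolding trace_hecke_T[OF sm assms(4,7) finite_vois[OF assms(5,6,7)] trans bspec[OF g], simplified]
    by (rule trace_hecke_average[OF vs])
qed

end
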